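(* Let $G(n,P)$ be the inhomogeneous random graph with vertex set $[n]=\{1,\ldots,n\}$ and symmetric matrix $P=(p_{ij})$ of edge probabilities, in which each edge $\{i,j\}$ is present with probability $p_{ij}$, independently of all other edges. Let $$p=\frac{\sum_{i<j}p_{ij}}{\binom n2}$$ be the average edge probability, with $p>0$. Then the chromatic number $\chi=\chi(G(n,P))$ has $N(0,\,n\ln n\,\sqrt p)$ tails upto $n\sqrt p$.
   Context: For positive reals $a,\sigma$, a random variable $X$ is said to have $N(0,\sigma^2)$ tails upto $a$ if there exist positive constants $c,c'$ such that for all $t\in[0,a]$, $\Pr(|X-EX|\ge t)\le c'e^{-ct^2/\sigma^2}$. Here $c,c'$ are absolute constants, independent of $n$ and $P$, while $a,\sigma$ may depend on $n$ and $P$. So here $\sigma^2=n(\ln n)\sqrt p$ and $a=n\sqrt p$. Take $n\ge 2$. *)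

theory Defs
  imports "HOL-Probability.Probability"
begin

text \<open>
  A simple graph with vertex set \<open>V\<close> is given by its edge set \<open>E\<close>, a set of two-element subsets
  of \<open>V\<close>.
\<close>

definition proper_coloring :: "'a set \<Rightarrow> 'a set set \<Rightarrow> nat \<Rightarrow> ('a \<Rightarrow> nat) \<Rightarrow> bool" where
  "proper_coloring V E k f \<longleftrightarrow>
     f ` V \<subseteq> {..<k} \<and> (\<forall>u\<in>V. \<forall>v\<in>V. {u, v} \<in> E \<longrightarrow> f u \<noteq> f v)"

text \<open>
  Meaningful for finite \<open>V\<close> and \<open>E\<close> without singletons; otherwise the set of admissible \<open>k\<close> may be
  empty.
\<close>

definition chromatic_number :: "'a set \<Rightarrow> 'a set set \<Rightarrow> nat" where
  "chromatic_number V E = (LEAST k. \<exists>f. proper_coloring V E k f)"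

definition potential_edges :: "nat \<Rightarrow> nat set set" where
  "potential_edges n = {{i, j} | i j. i \<in> {1..n} \<and> j \<in> {1..n} \<and> i \<noteq> j}"

text \<open>
  Only the entries with distinct indices in \<open>{1..n}\<close> matter: \<open>G(n,P)\<close> has no loops, so the diagonal
  of \<open>P\<close> is left unconstrained.
\<close>

definition edge_probability_matrix :: "nat \<Rightarrow> (nat \<Rightarrow> nat \<Rightarrow> real) \<Rightarrow> bool" where
  "edge_probability_matrix n P \<longleftrightarrow>
     (\<forall>i\<in>{1..n}. \<forall>j\<in>{1..n}. i \<noteq> j \<longrightarrow> P i j = P j i \<and> 0 \<le> P i j \<and> P i j \<le> 1)"

text \<open>
  For \<open>e = {i, j}\<close> with \<open>i \<noteq> j\<close>, the parameter \<open>P (Min e) (Max e)\<close> is \<open>P i j\<close>, by symmetry of \<open>P\<close>.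
  The product distribution \<open>Pi_pmf\<close> makes the edge indicators independent.
\<close>

definition inhomogeneous_random_graph :: "nat \<Rightarrow> (nat \<Rightarrow> nat \<Rightarrow> real) \<Rightarrow> nat set set pmf" where
  "inhomogeneous_random_graph n P =
     map_pmf (\<lambda>present. {e \<in> potential_edges n. present e})
       (Pi_pmf (potential_edges n) False (\<lambda>e. bernoulli_pmf (P (Min e) (Max e))))"

definition average_edge_probability :: "nat \<Rightarrow> (nat \<Rightarrow> nat \<Rightarrow> real) \<Rightarrow> real" where
  "average_edge_probability n P =
     (\<Sum>(i, j) \<in> {(i, j). i \<in> {1..n} \<and> j \<in> {1..n} \<and> i < j}. P i j) / real (n choose 2)"

text \<open>
  The random variable \<open>X\<close> on \<open>M\<close> has \<open>N(0, v)\<close> tails up to \<open>a\<close>, with constants \<open>c\<close> and \<open>c'\<close>.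
  The second parameter of the normal distribution is the variance, so \<open>v\<close> stands for the square
  of the standard deviation. The constants are explicit so that they can be
  quantified before everything that \<open>M\<close>, \<open>X\<close>, \<open>v\<close> and \<open>a\<close> depend on.
\<close>

definition has_normal_tails ::
  "real \<Rightarrow> real \<Rightarrow> 'a measure \<Rightarrow> ('a \<Rightarrow> real) \<Rightarrow> real \<Rightarrow> real \<Rightarrow> bool" where
  "has_normal_tails c c' M X v a \<longleftrightarrow>
     (\<forall>t\<in>{0..a}. measure M {\<omega> \<in> space M. \<bar>X \<omega> - integral\<^sup>L M X\<bar> \<ge> t} \<le> c' * exp (- c * t\<^sup>2 / v))"

end

theory Submission
  imports Defs
begin

text \<open>
  Let \<open>v = n * sqrt p\<close>. The vertices can be partitioned into \<open>O(v)\<close> blocks, each with at most 2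
  expected internal edges. Exposing the edges block by block (an edge belongs to its later block), a
  block changes the chromatic number by at most its own chromatic number: deleting the block gives a
  graph that does not depend on the exposed edges, and adding it back costs at most one color plus one
  per internal edge. That number has bounded exponential moments, so the chromatic number behaves
  like a sum of \<open>O(v)\<close> independent variables with bounded variance, and Chernoff's method with
  exponent \<open>t / O(v) \<le> 1\<close> gives the tail \<open>exp (- c * t\<^sup>2 / v)\<close>, which is even better than claimed. For
  \<open>v < 1\<close> the bound is trivial.
\<close>

subsection \<open>Exponential moments under independent blocks\<close>

lemma expectation_pair_pmf:
  fixes f :: "'a \<times> 'b \<Rightarrow> real"
  assumes "finite (set_pmf p)" "finite (set_pmf q)"
  shows "measure_pmf.expectation (pair_pmf p q) f =
    measure_pmf.expectation q (\<lambda>y. measure_pmf.expectation p (\<lambda>x. f (x, y)))"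
proof -
  have "measure_pmf.expectation (pair_pmf p q) f =
      (\<Sum>a\<in>set_pmf p \<times> set_pmf q. f a * pmf (pair_pmf p q) a)"
    using assms by (intro integral_measure_pmf_real) auto
  also have "\<dots> = (\<Sum>x\<in>set_pmf p. \<Sum>y\<in>set_pmf q. f (x, y) * (pmf p x * pmf q y))"
    unfolding sum.cartesian_product by (intro sum.cong) (auto simp: pmf_pair)
  also have "\<dots> = (\<Sum>y\<in>set_pmf q. (\<Sum>x\<in>set_pmf p. f (x, y) * pmf p x) * pmf q y)"
    by (subst sum.swap) (simp add: sum_distrib_right mult.assoc)
  also have "\<dots> = measure_pmf.expectation q (\<lambda>y. \<Sum>x\<in>set_pmf p. f (x, y) * pmf p x)"
    using assms by (intro integral_measure_pmf_real [symmetric]) auto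
  also have "\<dots> = measure_pmf.expectation q (\<lambda>y. measure_pmf.expectation p (\<lambda>x. f (x, y)))"
    using assms by (intro Bochner_Integration.integral_cong integral_measure_pmf_real [symmetric]) auto
  finally show ?thesis .
qed

lemma finite_set_Pi_pmf:
  assumes "finite A" "\<And>x. x \<in> A \<Longrightarrow> finite (set_pmf (q x))"
  shows "finite (set_pmf (Pi_pmf A d q))"
  using assms by (simp add: set_Pi_pmf finite_PiE_dflt)

lemma expectation_mono_pmf:
  fixes f g :: "'a \<Rightarrow> real"
  assumes "finite (set_pmf M)" "\<And>x. f x \<le> g x"
  shows "measure_pmf.expectation M f \<le> measure_pmf.expectation M g"
  using assms by (intro integral_mono integrable_measure_pmf_finite) auto

text \<open>Taylor's formula of order two: in the remainder both \<open>exp t\<close> and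
  \<open>d\<^sup>2 / 2\<close> are at most \<open>exp y\<close>. The linear term is kept because it
  averages to zero for centered \<open>d\<close>, which leaves an error of order
  \<open>l\<^sup>2\<close>.\<close>

lemma exp_le_quadratic:
  fixes l d y :: real
  assumes "\<bar>l\<bar> \<le> 1" "\<bar>d\<bar> \<le> y"
  shows "exp (l * d) \<le> 1 + l * d + l\<^sup>2 * exp (2 * y)"
proof -
  obtain t where t: "\<bar>t\<bar> \<le> \<bar>l * d\<bar>"
    "exp (l * d) = (\<Sum>m<2. (l * d) ^ m / fact m) + exp t / fact 2 * (l * d) ^ 2"
    using Maclaurin_exp_le [of "l * d" 2] by blast
  have "\<bar>l * d\<bar> \<le> 1 * y"
    unfolding abs_mult using assms by (intro mult_mono) auto
  hence et: "exp t \<le> exp y" using t(1) by simp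
  have "d\<^sup>2 \<le> y\<^sup>2" using assms(2) by (simp add: abs_le_square_iff [symmetric])
  also have "y\<^sup>2 / 2 \<le> exp y" using exp_lower_Taylor_quadratic [of y] assms(2) by linarith
  hence "y\<^sup>2 \<le> 2 * exp y" by simp
  finally have "exp t * d\<^sup>2 \<le> exp y * (2 * exp y)"
    using et by (intro mult_mono) auto
  hence "l\<^sup>2 * (exp t * d\<^sup>2) \<le> l\<^sup>2 * (2 * exp (2 * y))"
    using mult_exp_exp [of y y] by (intro mult_left_mono) auto
  moreover have "exp (l * d) = 1 + l * d + l\<^sup>2 * (exp t * d\<^sup>2) / 2"
    unfolding t(2) by (simp add: lessThan_nat_numeral lessThan_Suc power_mult_distrib)
  ultimately show ?thesis by linarith
qed

text \<open>Jensen's inequality for \<open>exp\<close>, obtained from its tangent line at the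
  mean.\<close>

lemma exp_expectation_le:
  fixes Y :: "'a \<Rightarrow> real"
  assumes fin: "finite (set_pmf M)"
  shows "exp (measure_pmf.expectation M Y) \<le> measure_pmf.expectation M (\<lambda>x. exp (Y x))"
proof -
  let ?\<mu> = "measure_pmf.expectation M Y"
  note int = integrable_measure_pmf_finite [OF fin]
  have "exp ?\<mu> = measure_pmf.expectation M (\<lambda>x. exp ?\<mu> * (1 + (Y x - ?\<mu>)))"
    by (simp add: int)
  also have "\<dots> \<le> measure_pmf.expectation M (\<lambda>x. exp (Y x))"
  proof (rule expectation_mono_pmf [OF fin])
    fix x
    have "exp ?\<mu> * (1 + (Y x - ?\<mu>)) \<le> exp ?\<mu> * exp (Y x - ?\<mu>)"
      by (intro mult_left_mono exp_ge_add_one_self) auto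
    thus "exp ?\<mu> * (1 + (Y x - ?\<mu>)) \<le> exp (Y x)" by (simp add: exp_diff)
  qed
  finally show ?thesis .
qed

text \<open>\<open>Z\<close> deviates from its mean by at most \<open>Y\<close> plus the mean of
  \<open>Y\<close>, so the quadratic bound applies and its linear term averages out. Jensen's
  inequality turns the exponential of the mean of \<open>2 * Y\<close> into a second copy of the
  exponential moment, whence the square.\<close>

lemma mgf_le_of_bounded:
  fixes Y Z :: "'a \<Rightarrow> real"
  assumes fin: "finite (set_pmf M)" and Z: "\<And>x. 0 \<le> Z x" "\<And>x. Z x \<le> Y x" and l: "\<bar>l\<bar> \<le> 1"
  shows "measure_pmf.expectation M (\<lambda>x. exp (l * (Z x - measure_pmf.expectation M Z)))
    \<le> exp (l\<^sup>2 * (measure_pmf.expectation M (\<lambda>x. exp (2 * Y x)))\<^sup>2)"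
proof -
  let ?E = "measure_pmf.expectation M"
  note int = integrable_measure_pmf_finite [OF fin]
  have EZ: "0 \<le> ?E Z" "?E Z \<le> ?E Y"
    using Z expectation_mono_pmf [OF fin, of Z Y] by (auto intro: Bochner_Integration.integral_nonneg)
  have "?E (\<lambda>x. exp (l * (Z x - ?E Z)))
      \<le> ?E (\<lambda>x. 1 + l * (Z x - ?E Z) + l\<^sup>2 * exp (2 * (Y x + ?E Y)))"
  proof (rule expectation_mono_pmf [OF fin])
    fix x
    have "\<bar>Z x - ?E Z\<bar> \<le> Y x + ?E Y" using Z(1)[of x] Z(2)[of x] EZ by linarith
    thus "exp (l * (Z x - ?E Z)) \<le> 1 + l * (Z x - ?E Z) + l\<^sup>2 * exp (2 * (Y x + ?E Y))"
      by (rule exp_le_quadratic [OF l])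
  qed
  also have "\<dots> = 1 + l\<^sup>2 * (?E (\<lambda>x. exp (2 * Y x)) * exp (?E (\<lambda>x. 2 * Y x)))"
    by (simp add: int exp_add distrib_left)
  also have "\<dots> \<le> 1 + l\<^sup>2 * (?E (\<lambda>x. exp (2 * Y x)) * ?E (\<lambda>x. exp (2 * Y x)))"
    by (intro add_left_mono mult_left_mono exp_expectation_le fin Bochner_Integration.integral_nonneg) auto
  also have "\<dots> \<le> exp (l\<^sup>2 * (?E (\<lambda>x. exp (2 * Y x)))\<^sup>2)"
    unfolding power2_eq_square by (rule exp_ge_add_one_self)
  finally show ?thesis .
qed

text \<open>
  Each block \<open>A b\<close> of independent coordinates moves \<open>X\<close> only within a window of width \<open>Y b\<close> above
  a quantity \<open>L\<close> that ignores the block. This property survives averaging over another block,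
  so the blocks can be integrated out one at a time and no martingale is needed.
\<close>

lemma mgf_le_prod_blocks:
  fixes X :: "('i \<Rightarrow> 'c) \<Rightarrow> real" and Y :: "'b \<Rightarrow> ('i \<Rightarrow> 'c) \<Rightarrow> real"
  assumes "finite J" "\<forall>b\<in>J. finite (A b)" "disjoint_family_on A J"
    and "\<forall>x. finite (set_pmf (q x))"
    and "\<forall>b\<in>J. \<exists>L. (\<forall>\<omega> \<omega>'. (\<forall>i. i \<notin> A b \<longrightarrow> \<omega> i = \<omega>' i) \<longrightarrow> L \<omega> = L \<omega>') \<and>
          (\<forall>\<omega>. L \<omega> \<le> X \<omega> \<and> X \<omega> \<le> L \<omega> + Y b \<omega>)"
    and "\<forall>b\<in>J. \<forall>\<omega> \<omega>'. (\<forall>i\<in>A b. \<omega> i = \<omega>' i) \<longrightarrow> Y b \<omega> = Y b \<omega>'"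
    and "\<forall>b\<in>J. \<forall>Z. (\<forall>\<omega>. 0 \<le> Z \<omega> \<and> Z \<omega> \<le> Y b \<omega>) \<longrightarrow>
          measure_pmf.expectation (Pi_pmf (A b) d q)
            (\<lambda>\<omega>. exp (l * (Z \<omega> - measure_pmf.expectation (Pi_pmf (A b) d q) Z))) \<le> \<Phi> b"
  shows "measure_pmf.expectation (Pi_pmf (\<Union>b\<in>J. A b) d q)
      (\<lambda>\<omega>. exp (l * (X \<omega> - measure_pmf.expectation (Pi_pmf (\<Union>b\<in>J. A b) d q) X)))
    \<le> (\<Prod>b\<in>J. \<Phi> b)"
  using assms
proof (induction J arbitrary: X rule: finite_induct)
  case empty
  show ?case by simp
next
  case (insert b J)
  note finA = insert.prems(1) and disj = insert.prems(2) and finq = insert.prems(3)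
    and bd = insert.prems(4) and loc = insert.prems(5) and mgf = insert.prems(6)
  define U where "U = (\<Union>c\<in>J. A c)"
  define p where "p = Pi_pmf (A b) d q"
  define r where "r = Pi_pmf U d q"
  \<comment> \<open>\<open>m f g\<close> glues an outcome \<open>f\<close> of block \<open>b\<close>
    to an outcome \<open>g\<close> of the remaining blocks. The average \<open>h\<close> of
    \<open>X\<close> over block \<open>b\<close> takes the place of \<open>X\<close> in the
    induction hypothesis.\<close>
  define m where "m = (\<lambda>f g x. if x \<in> A b then f x else g x :: 'c)"
  define h where "h g = measure_pmf.expectation p (\<lambda>f. X (m f g))" for g
  have finU: "finite U" using insert.hyps finA by (auto simp: U_def)
  have disjAU: "A b \<inter> U = {}"
    unfolding U_def using disjoint_family_onD [OF disj, of b] insert.hyps(2) by auto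
  have fp: "finite (set_pmf p)" and fr: "finite (set_pmf r)"
    unfolding p_def r_def using finA finU finq by (simp_all add: finite_set_Pi_pmf)
  note intp = integrable_measure_pmf_finite [OF fp]
  have exp_split: "measure_pmf.expectation (Pi_pmf (\<Union>c\<in>insert b J. A c) d q) F =
      measure_pmf.expectation r (\<lambda>g. measure_pmf.expectation p (\<lambda>f. F (m f g)))"
    for F :: "('i \<Rightarrow> 'c) \<Rightarrow> real"
  proof -
    have "Pi_pmf (\<Union>c\<in>insert b J. A c) d q = map_pmf (\<lambda>(f, g). m f g) (pair_pmf p r)"
      unfolding p_def r_def m_def using Pi_pmf_union [OF _ finU disjAU, where dflt = d and p = q]
        finA by (simp add: U_def)
    thus ?thesis by (simp add: expectation_pair_pmf [OF fp fr])
  qed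
  have IH: "measure_pmf.expectation r (\<lambda>g. exp (l * (h g - measure_pmf.expectation r h)))
      \<le> (\<Prod>c\<in>J. \<Phi> c)"
    unfolding r_def U_def
  proof (rule insert.IH)
    show "\<forall>c\<in>J. \<exists>L. (\<forall>\<omega> \<omega>'. (\<forall>i. i \<notin> A c \<longrightarrow> \<omega> i = \<omega>' i) \<longrightarrow> L \<omega> = L \<omega>') \<and>
          (\<forall>\<omega>. L \<omega> \<le> h \<omega> \<and> h \<omega> \<le> L \<omega> + Y c \<omega>)"
    proof
      fix c assume c: "c \<in> J"
      hence disjbc: "A b \<inter> A c = {}" using disjAU by (auto simp: U_def)
      obtain L where L1: "\<And>\<omega> \<omega>'. (\<forall>i. i \<notin> A c \<longrightarrow> \<omega> i = \<omega>' i) \<Longrightarrow> L \<omega> = L \<omega>'"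
        and L2: "\<And>\<omega>. L \<omega> \<le> X \<omega>" "\<And>\<omega>. X \<omega> \<le> L \<omega> + Y c \<omega>"
        using bspec [OF bd, of c] c by blast
      have Ym: "Y c (m f g) = Y c g" for f g
        using c disjbc by (intro loc [rule_format]) (auto simp: m_def)
      show "\<exists>L. (\<forall>\<omega> \<omega>'. (\<forall>i. i \<notin> A c \<longrightarrow> \<omega> i = \<omega>' i) \<longrightarrow> L \<omega> = L \<omega>') \<and>
            (\<forall>\<omega>. L \<omega> \<le> h \<omega> \<and> h \<omega> \<le> L \<omega> + Y c \<omega>)"
      \<comment> \<open>The witness for \<open>h\<close> is the average of the witness for
        \<open>X\<close>: glued arguments still agree off \<open>A c\<close>, and \<open>Y c\<close>
        does not see block \<open>b\<close> because the blocks are disjoint.\<close>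
      proof (intro exI [of _ "\<lambda>g. measure_pmf.expectation p (\<lambda>f. L (m f g))"] conjI allI impI)
        fix g g' :: "'i \<Rightarrow> 'c" assume "\<forall>i. i \<notin> A c \<longrightarrow> g i = g' i"
        hence "L (m f g) = L (m f g')" for f by (intro L1) (auto simp: m_def)
        thus "measure_pmf.expectation p (\<lambda>f. L (m f g)) = measure_pmf.expectation p (\<lambda>f. L (m f g'))"
          by simp
      next
        fix g show "measure_pmf.expectation p (\<lambda>f. L (m f g)) \<le> h g"
          unfolding h_def by (rule expectation_mono_pmf [OF fp L2(1)])
      next
        fix g
        have "h g \<le> measure_pmf.expectation p (\<lambda>f. L (m f g) + Y c g)"
          unfolding h_def using L2(2) Ym by (intro expectation_mono_pmf [OF fp]) metis
        thus "h g \<le> measure_pmf.expectation p (\<lambda>f. L (m f g)) + Y c g"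
          by (simp add: intp)
      qed
    qed
  qed (use insert.prems in \<open>auto simp: disjoint_family_on_def\<close>)
  \<comment> \<open>With \<open>g\<close> fixed, \<open>L\<close> is constant on block
    \<open>b\<close>, so subtracting it from \<open>X\<close> gives a function \<open>Z\<close>
    between 0 and \<open>Y b\<close>, to which the assumption on block \<open>b\<close>
    applies.\<close>
  have step: "measure_pmf.expectation p (\<lambda>f. exp (l * (X (m f g) - h g))) \<le> \<Phi> b" for g
  proof -
    obtain L where L1: "\<And>\<omega> \<omega>'. (\<forall>i. i \<notin> A b \<longrightarrow> \<omega> i = \<omega>' i) \<Longrightarrow> L \<omega> = L \<omega>'"
      and L2: "\<And>\<omega>. L \<omega> \<le> X \<omega>" "\<And>\<omega>. X \<omega> \<le> L \<omega> + Y b \<omega>"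
      using bspec [OF bd, of b] by blast
    define Z where "Z f = X (m f g) - L g" for f
    have Lm: "L (m f g) = L g" for f by (intro L1) (auto simp: m_def)
    have Ym: "Y b (m f g) = Y b f" for f by (intro loc [rule_format]) (auto simp: m_def)
    have EZ: "measure_pmf.expectation p Z = h g - L g"
      unfolding Z_def h_def by (simp add: intp)
    have "0 \<le> Z f \<and> Z f \<le> Y b f" for f
      using L2 [of "m f g"] by (simp add: Z_def Lm Ym)
    moreover have "Z f - measure_pmf.expectation p Z = X (m f g) - h g" for f
      by (simp add: EZ) (simp add: Z_def)
    ultimately show ?thesis using bspec [OF mgf, of b, THEN spec, of Z] by (simp add: p_def)
  qed
  let ?Eh = "measure_pmf.expectation r h"
  have "measure_pmf.expectation (Pi_pmf (\<Union>c\<in>insert b J. A c) d q)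
      (\<lambda>\<omega>. exp (l * (X \<omega> - measure_pmf.expectation (Pi_pmf (\<Union>c\<in>insert b J. A c) d q) X)))
    = measure_pmf.expectation r (\<lambda>g. measure_pmf.expectation p (\<lambda>f. exp (l * (X (m f g) - ?Eh))))"
    unfolding exp_split h_def ..
  \<comment> \<open>The deviation splits into \<open>h g - ?Eh\<close>, constant in the inner
    expectation, and \<open>X (m f g) - h g\<close>, controlled by \<open>step\<close>.\<close>
  also have "\<dots> = measure_pmf.expectation r (\<lambda>g. exp (l * (h g - ?Eh)) *
      measure_pmf.expectation p (\<lambda>f. exp (l * (X (m f g) - h g))))"
  proof -
    have "exp (l * (X (m f g) - ?Eh)) = exp (l * (h g - ?Eh)) * exp (l * (X (m f g) - h g))" for f g
      by (simp add: algebra_simps flip: exp_add)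
    thus ?thesis by simp
  qed
  also have "\<dots> \<le> measure_pmf.expectation r (\<lambda>g. exp (l * (h g - ?Eh)) * \<Phi> b)"
    by (intro expectation_mono_pmf [OF fr] mult_left_mono step) auto
  also have "\<dots> \<le> (\<Prod>c\<in>J. \<Phi> c) * \<Phi> b"
  proof -
    \<comment> \<open>Multiplying the induction hypothesis by \<open>\<Phi> b\<close> requires its
      sign, which \<open>step\<close> yields at any single point.\<close>
    have "0 \<le> measure_pmf.expectation p (\<lambda>f. exp (l * (X (m f undefined) - h undefined)))"
      by simp
    hence "0 \<le> \<Phi> b" using step by (rule order_trans)
    thus ?thesis using IH by (simp add: mult_right_mono)
  qed
  finally show ?case using insert.hyps by (simp add: mult.commute)
qed

text \<open>Chernoff's method: Markov's inequality for the exponential with \<open>s = l\<close>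
  handles the upper tail, with \<open>s = - l\<close> the lower one; the union bound gives the
  factor 2.\<close>

lemma tail_le_of_mgf:
  fixes X :: "'a \<Rightarrow> real"
  assumes fin: "finite (set_pmf M)"
    and mgf: "\<And>s. \<bar>s\<bar> = l \<Longrightarrow>
      measure_pmf.expectation M (\<lambda>x. exp (s * (X x - measure_pmf.expectation M X))) \<le> B"
    and l: "0 < l"
  shows "measure_pmf.prob M {x. t \<le> \<bar>X x - measure_pmf.expectation M X\<bar>} \<le> 2 * (exp (- l * t) * B)"
proof -
  let ?D = "\<lambda>x. X x - measure_pmf.expectation M X"
  have one: "measure_pmf.prob M {x. exp (l * t) \<le> exp (s * ?D x)} \<le> exp (- l * t) * B"
    if "\<bar>s\<bar> = l" for s
  proof -
    have "measure_pmf.prob M {x \<in> space M. exp (l * t) \<le> exp (s * ?D x)}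
        \<le> measure_pmf.expectation M (\<lambda>x. exp (s * ?D x)) / exp (l * t)"
      by (intro integral_Markov_inequality_measure [where A = "{}"]
            integrable_measure_pmf_finite fin) auto
    also have "\<dots> \<le> B / exp (l * t)" using mgf [OF that] by (simp add: divide_right_mono)
    finally show ?thesis by (simp add: exp_minus field_simps)
  qed
  have "{x. t \<le> \<bar>?D x\<bar>} \<subseteq> {x. exp (l * t) \<le> exp (l * ?D x)} \<union> {x. exp (l * t) \<le> exp (- l * ?D x)}"
  proof
    fix x assume "x \<in> {x. t \<le> \<bar>?D x\<bar>}"
    hence "t \<le> ?D x \<or> t \<le> - ?D x" by auto
    hence "l * t \<le> l * ?D x \<or> l * t \<le> - l * ?D x" using l by (auto simp flip: mult_minus_right)
    thus "x \<in> {x. exp (l * t) \<le> exp (l * ?D x)} \<union> {x. exp (l * t) \<le> exp (- l * ?D x)}" by auto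
  qed
  hence "measure_pmf.prob M {x. t \<le> \<bar>?D x\<bar>} \<le> measure_pmf.prob M
      ({x. exp (l * t) \<le> exp (l * ?D x)} \<union> {x. exp (l * t) \<le> exp (- l * ?D x)})"
    by (intro measure_pmf.finite_measure_mono) auto
  also have "\<dots> \<le> exp (- l * t) * B + exp (- l * t) * B"
    using one [of l] one [of "- l"] l
    by (intro order_trans [OF measure_Un_le] add_mono) auto
  finally show ?thesis by (simp add: mult.commute)
qed

subsection \<open>Partitions into blocks of small weight\<close>

text \<open>For edge probabilities \<open>w\<close> this is the expected number of edges inside
  block \<open>b\<close>. Pairs are grouped by their larger vertex, so appending vertex
  \<open>Suc m\<close> adds just one inner sum.\<close>

definition block_weight :: "(nat \<Rightarrow> nat \<Rightarrow> real) \<Rightarrow> nat \<Rightarrow> (nat \<Rightarrow> nat) \<Rightarrow> nat \<Rightarrow> real" where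
  "block_weight w m f b = (\<Sum>v\<in>{1..m}. \<Sum>u\<in>{1..<v}. if f u = b \<and> f v = b then w u v else 0)"

lemma block_weight_Suc_update:
  "block_weight w (Suc m) (f(Suc m := c)) b =
    block_weight w m f b + (if b = c then \<Sum>u\<in>{1..m}. if f u = c then w u (Suc m) else 0 else 0)"
proof -
  have "block_weight w m (f(Suc m := c)) b = block_weight w m f b"
    unfolding block_weight_def by (intro sum.cong) auto
  moreover have "(\<Sum>u\<in>{1..<Suc m}. if (f(Suc m := c)) u = b \<and> (f(Suc m := c)) (Suc m) = b
        then w u (Suc m) else 0)
      = (if b = c then \<Sum>u\<in>{1..m}. if f u = c then w u (Suc m) else 0 else 0)"
    by (auto intro!: sum.cong sum.neutral simp: atLeastLessThanSuc_atLeastAtMost)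
  ultimately show ?thesis by (simp add: block_weight_def)
qed

lemma block_weight_eq_0:
  assumes "\<And>v. v \<in> {1..m} \<Longrightarrow> f v \<noteq> b"
  shows "block_weight w m f b = 0"
  unfolding block_weight_def using assms by (intro sum.neutral ballI) auto

lemma block_weight_nonneg:
  assumes "\<forall>v\<in>{1..m}. \<forall>u\<in>{1..<v}. 0 \<le> w u v"
  shows "0 \<le> block_weight w m f b"
  unfolding block_weight_def using assms by (intro sum_nonneg) auto

text \<open>
  Greedy construction: \<open>A\<close> is a set of \<open>k\<close> active blocks. A vertex with backward degree above \<open>k\<close> gets
  a block of its own; any other vertex adds at most the average \<open>1/k\<close> of its backward degree to
  some active block, which is replaced by an empty one as soon as its weight exceeds 1. The last
  conjunct is the potential that controls the number of blocks.
\<close>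

lemma exists_light_partition_aux:
  fixes w :: "nat \<Rightarrow> nat \<Rightarrow> real"
  assumes k: "k \<ge> 1" and w: "\<forall>v\<in>{1..m}. \<forall>u\<in>{1..<v}. 0 \<le> w u v"
  shows "\<exists>f N A. (\<forall>v\<in>{1..m}. f v < N) \<and> (\<forall>b. block_weight w m f b \<le> 2) \<and>
    A \<subseteq> {..<N} \<and> card A = k \<and> (\<forall>b\<in>A. block_weight w m f b \<le> 1) \<and>
    real N + (\<Sum>b\<in>A. block_weight w m f b) \<le> real k + (\<Sum>v\<in>{1..m}. \<Sum>u\<in>{1..<v}. w u v) / real k"
  using w
proof (induction m)
  case 0
  show ?case
    by (intro exI [of _ "\<lambda>_. 0"] exI [of _ k] exI [of _ "{..<k}"]) (auto simp: block_weight_def)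
next
  case (Suc m)
  have w0: "\<forall>v\<in>{1..m}. \<forall>u\<in>{1..<v}. 0 \<le> w u v" using Suc.prems by simp
  obtain f N A where f: "\<And>v. v \<in> {1..m} \<Longrightarrow> f v < N" and two: "\<And>b. block_weight w m f b \<le> 2"
    and A: "A \<subseteq> {..<N}" "card A = k" and one: "\<And>b. b \<in> A \<Longrightarrow> block_weight w m f b \<le> 1"
    and pot: "real N + (\<Sum>b\<in>A. block_weight w m f b)
      \<le> real k + (\<Sum>v\<in>{1..m}. \<Sum>u\<in>{1..<v}. w u v) / real k"
    using Suc.IH [OF w0] by blast
  \<comment> \<open>\<open>d\<close> is the backward degree of the new vertex, and
    \<open>\<delta> c\<close> is the weight that block \<open>c\<close> gains by receiving
    it.\<close>
  define d where "d = (\<Sum>u\<in>{1..m}. w u (Suc m))"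
  define \<delta> where "\<delta> c = (\<Sum>u\<in>{1..m}. if f u = c then w u (Suc m) else 0)" for c
  have bw: "block_weight w (Suc m) (f(Suc m := c)) b = block_weight w m f b + (if b = c then \<delta> c else 0)"
    for b c by (simp add: block_weight_Suc_update \<delta>_def)
  have bwN: "block_weight w m f N = 0" using f by (intro block_weight_eq_0) fastforce
  have \<delta>N: "\<delta> N = 0" unfolding \<delta>_def using f by (intro sum.neutral) fastforce
  have finA: "finite A" using A(1) finite_subset by blast
  have NA: "N \<notin> A" using A(1) by auto
  have W: "(\<Sum>v\<in>{1..Suc m}. \<Sum>u\<in>{1..<v}. w u v) / real k
      = (\<Sum>v\<in>{1..m}. \<Sum>u\<in>{1..<v}. w u v) / real k + d / real k"
    by (simp add: d_def add_divide_distrib atLeastLessThanSuc_atLeastAtMost)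
  consider (heavy) "d > real k" | (light) "d \<le> real k" by linarith
  thus ?case
  proof cases
    \<comment> \<open>The fresh block \<open>N\<close> stays inactive, and its cost of 1 in the
      potential is paid by \<open>d / real k\<close>.\<close>
    case heavy
    hence dk: "1 \<le> d / real k" using k by simp
    show ?thesis
    proof (intro exI [of _ "f(Suc m := N)"] exI [of _ "Suc N"] exI [of _ A] conjI ballI allI)
      fix v assume "v \<in> {1..Suc m}"
      thus "(f(Suc m := N)) v < Suc N" using f [of v] by auto
    next
      have "(\<Sum>b\<in>A. block_weight w (Suc m) (f(Suc m := N)) b) = (\<Sum>b\<in>A. block_weight w m f b)"
        by (intro sum.cong) (auto simp: bw \<delta>N)
      thus "real (Suc N) + (\<Sum>b\<in>A. block_weight w (Suc m) (f(Suc m := N)) b)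
        \<le> real k + (\<Sum>v\<in>{1..Suc m}. \<Sum>u\<in>{1..<v}. w u v) / real k"
        using pot dk unfolding W by simp
    qed (use A one two in \<open>auto simp: bw \<delta>N bwN simp del: fun_upd_apply\<close>)
  next
    case light
    have "(\<Sum>c\<in>A. \<delta> c) = (\<Sum>u\<in>{1..m}. \<Sum>c\<in>A. if f u = c then w u (Suc m) else 0)"
      unfolding \<delta>_def by (rule sum.swap)
    also have "\<dots> \<le> d"
      unfolding d_def using Suc.prems finA by (intro sum_mono) (auto simp: sum.delta)
    finally have sum_\<delta>: "(\<Sum>c\<in>A. \<delta> c) \<le> d" .
    \<comment> \<open>Pigeonhole: each earlier vertex lies in at most one active block, so the
      \<open>k\<close> gains add up to at most \<open>d\<close>.\<close>
    have "\<exists>c\<in>A. \<delta> c \<le> d / real k"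
    proof (rule ccontr)
      assume "\<not> ?thesis"
      hence "(\<Sum>c\<in>A. d / real k) < (\<Sum>c\<in>A. \<delta> c)"
        using A(2) k finA by (intro sum_strict_mono) (auto simp: not_le)
      thus False using sum_\<delta> A(2) k by simp
    qed
    then obtain c where c: "c \<in> A" and \<delta>c: "\<delta> c \<le> d / real k" by blast
    have \<delta>1: "\<delta> c \<le> 1" using \<delta>c light k by (simp add: order_trans)
    have sumA: "(\<Sum>b\<in>A. block_weight w m f b) =
        block_weight w m f c + (\<Sum>b\<in>A - {c}. block_weight w m f b)"
      using c finA by (simp add: sum.remove)
    have sumA': "(\<Sum>b\<in>A - {c}. block_weight w (Suc m) (f(Suc m := c)) b) =
        (\<Sum>b\<in>A - {c}. block_weight w m f b)"
      by (intro sum.cong) (auto simp: bw simp del: fun_upd_apply)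
    have two': "block_weight w (Suc m) (f(Suc m := c)) b \<le> 2" for b
      using two [of b] one [OF c] \<delta>1 by (auto simp: bw simp del: fun_upd_apply)
    have f': "(f(Suc m := c)) v < N" if "v \<in> {1..Suc m}" for v
      using f [of v] that c A(1) by auto
    show ?thesis
    proof (cases "block_weight w m f c + \<delta> c \<le> 1")
      case True
      have "(\<Sum>b\<in>A. block_weight w (Suc m) (f(Suc m := c)) b) =
          block_weight w m f c + \<delta> c + (\<Sum>b\<in>A - {c}. block_weight w m f b)"
        using c finA sumA' by (simp add: sum.remove bw)
      hence "real N + (\<Sum>b\<in>A. block_weight w (Suc m) (f(Suc m := c)) b)
        \<le> real k + (\<Sum>v\<in>{1..Suc m}. \<Sum>u\<in>{1..<v}. w u v) / real k"
        using pot \<delta>c sumA unfolding W by linarith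
      moreover have "\<forall>b\<in>A. block_weight w (Suc m) (f(Suc m := c)) b \<le> 1"
        using one True by (auto simp: bw simp del: fun_upd_apply)
      ultimately show ?thesis
        using A f' two' by (intro exI [of _ "f(Suc m := c)"] exI [of _ N] exI [of _ A] conjI) blast+
    next
      case False
      \<comment> \<open>Retiring \<open>c\<close> removes its old weight, which exceeds
        \<open>1 - \<delta> c\<close>, from the active sum. The new block costs 1, so the potential
        grows by less than \<open>\<delta> c\<close>, hence by less than
        \<open>d / real k\<close>.\<close>
      let ?A = "insert N (A - {c})"
      have cN: "c \<noteq> N" using c NA by auto
      have bwN': "block_weight w (Suc m) (f(Suc m := c)) N = 0" using cN by (simp add: bw bwN)
      have "real (Suc N) + (\<Sum>b\<in>?A. block_weight w (Suc m) (f(Suc m := c)) b)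
        \<le> real k + (\<Sum>v\<in>{1..Suc m}. \<Sum>u\<in>{1..<v}. w u v) / real k"
        using finA NA pot \<delta>c sumA sumA' bwN' False unfolding W by simp
      moreover have "\<forall>b\<in>?A. block_weight w (Suc m) (f(Suc m := c)) b \<le> 1"
        using one bwN' by (auto simp: bw simp del: fun_upd_apply)
      moreover have "card ?A = k" using finA NA c A(2) k by (simp add: card_Diff_singleton)
      moreover have "?A \<subseteq> {..<Suc N}" using A(1) by auto
      moreover have "\<forall>v\<in>{1..Suc m}. (f(Suc m := c)) v < Suc N" using f' less_SucI by blast
      ultimately show ?thesis
        using two' by (intro exI [of _ "f(Suc m := c)"] exI [of _ "Suc N"] exI [of _ ?A] conjI) blast+
    qed
  qed
qed

lemma exists_light_partition:
  fixes w :: "nat \<Rightarrow> nat \<Rightarrow> real"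
  assumes k: "k \<ge> 1" and w: "\<forall>v\<in>{1..m}. \<forall>u\<in>{1..<v}. 0 \<le> w u v"
  shows "\<exists>f N. (\<forall>v\<in>{1..m}. f v < N) \<and> (\<forall>b. block_weight w m f b \<le> 2) \<and>
    real N \<le> real k + (\<Sum>v\<in>{1..m}. \<Sum>u\<in>{1..<v}. w u v) / real k"
  using exists_light_partition_aux [OF k w]
proof (elim exE conjE)
  fix f N A
  assume *: "\<forall>v\<in>{1..m}. f v < N" "\<forall>b. block_weight w m f b \<le> 2"
    "real N + (\<Sum>b\<in>A. block_weight w m f b) \<le> real k + (\<Sum>v\<in>{1..m}. \<Sum>u\<in>{1..<v}. w u v) / real k"
  have "0 \<le> (\<Sum>b\<in>A. block_weight w m f b)"
    using w by (intro sum_nonneg block_weight_nonneg)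
  hence "real N \<le> real k + (\<Sum>v\<in>{1..m}. \<Sum>u\<in>{1..<v}. w u v) / real k"
    using *(3) by linarith
  thus ?thesis using *(1,2) by (intro exI conjI)
qed

subsection \<open>Chromatic number and deletion of a block\<close>

lemma chromatic_number_le: "proper_coloring V E k f \<Longrightarrow> chromatic_number V E \<le> k"
  unfolding chromatic_number_def by (rule Least_le) blast

text \<open>Without loops, giving all vertices different colors is proper, so the minimum in the
  definition is attained.\<close>

lemma chromatic_number_coloring:
  assumes "finite V" "\<And>v. {v} \<notin> E"
  shows "\<exists>f. proper_coloring V E (chromatic_number V E) f"
proof -
  obtain h where h: "bij_betw h V {0..<card V}" using ex_bij_betw_finite_nat [OF assms(1)] by blast
  have "proper_coloring V E (card V) h"
    unfolding proper_coloring_def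
  proof (intro conjI ballI impI)
    show "h ` V \<subseteq> {..<card V}" using h by (auto simp: bij_betw_def)
    fix u v assume "u \<in> V" "v \<in> V" "{u, v} \<in> E"
    thus "h u \<noteq> h v" using assms(2) [of u] h by (auto simp: bij_betw_def inj_on_def)
  qed
  hence "\<exists>f. proper_coloring V E (card V) f" by blast
  thus ?thesis
    unfolding chromatic_number_def by (rule LeastI [of "\<lambda>k. \<exists>f. proper_coloring V E k f"])
qed

lemma chromatic_number_mono:
  assumes "finite V" "\<And>v. {v} \<notin> E" "W \<subseteq> V"
  shows "chromatic_number W E \<le> chromatic_number V E"
proof -
  obtain f where "proper_coloring V E (chromatic_number V E) f"
    using chromatic_number_coloring assms by metis
  hence "proper_coloring W E (chromatic_number V E) f"
    using assms(3) unfolding proper_coloring_def by blast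
  thus ?thesis by (rule chromatic_number_le)
qed

lemma chromatic_number_cong:
  assumes "\<And>u v. u \<in> V \<Longrightarrow> v \<in> V \<Longrightarrow> {u, v} \<in> E \<longleftrightarrow> {u, v} \<in> E'"
  shows "chromatic_number V E = chromatic_number V E'"
  using assms unfolding chromatic_number_def proper_coloring_def by (simp cong: ball_cong)

text \<open>Select one endpoint of every edge inside \<open>B\<close>. The unselected vertices of
  \<open>B\<close> span no edge and share one new color; each selected vertex gets a private
  color.\<close>

lemma chromatic_number_le_delete:
  assumes V: "finite V" and E: "finite E" "\<And>v. {v} \<notin> E"
  shows "chromatic_number V E \<le> chromatic_number (V - B) E + 1 + card {e \<in> E. e \<subseteq> B}"
proof -
  define I where "I = {e \<in> E. e \<subseteq> B}"
  define M where "M = (\<lambda>e. SOME x. x \<in> e) ` I"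
  define k where "k = chromatic_number (V - B) E"
  have finI: "finite I" using E(1) by (simp add: I_def)
  hence finM: "finite M" and cardM: "card M \<le> card I"
    by (auto simp: M_def card_image_le)
  have hit: "u \<in> M \<or> v \<in> M" if "{u, v} \<in> I" for u v
  proof -
    have "(SOME x. x \<in> {u, v}) \<in> {u, v}" by (rule someI [of _ u]) simp
    moreover have "(SOME x. x \<in> {u, v}) \<in> M" unfolding M_def using that by blast
    ultimately show ?thesis by auto
  qed
  obtain g where g: "proper_coloring (V - B) E k g"
    using chromatic_number_coloring [of "V - B" E] V E(2) unfolding k_def by auto
  obtain h where "bij_betw h M {0..<card M}" using ex_bij_betw_finite_nat [OF finM] by blast
  hence h: "inj_on h M" "\<And>x. x \<in> M \<Longrightarrow> h x < card M" by (auto simp: bij_betw_def)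
  \<comment> \<open>The three classes use colors below \<open>k\<close>, equal to \<open>k\<close>,
    and above \<open>k\<close>, so equal colors force the same class.\<close>
  define f where "f x = (if x \<in> V - B then g x else if x \<in> M then k + 1 + h x else k)" for x
  have gk: "g x < k" if "x \<in> V - B" for x using g that unfolding proper_coloring_def by auto
  have "proper_coloring V E (k + 1 + card M) f"
    unfolding proper_coloring_def
  proof (intro conjI ballI impI)
    show "f ` V \<subseteq> {..<k + 1 + card M}"
    proof
      fix y assume "y \<in> f ` V"
      then obtain x where "x \<in> V" "y = f x" by blast
      thus "y \<in> {..<k + 1 + card M}" using gk [of x] h(2) [of x] by (auto simp: f_def)
    qed
    fix u v assume uv: "u \<in> V" "v \<in> V" "{u, v} \<in> E"
    show "f u \<noteq> f v"
    proof
      assume eq: "f u = f v"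
      have ne: "u \<noteq> v" using uv(3) E(2) by auto
      have "u \<in> V - B \<longleftrightarrow> v \<in> V - B"
        using eq gk [of u] gk [of v] by (auto simp: f_def split: if_splits)
      moreover have "\<not> (u \<in> V - B \<and> v \<in> V - B)"
      proof
        assume "u \<in> V - B \<and> v \<in> V - B"
        thus False using eq g uv(3) by (auto simp: f_def proper_coloring_def)
      qed
      ultimately have B: "u \<in> B" "v \<in> B" using uv by auto
      hence "u \<in> M \<or> v \<in> M" using hit uv(3) by (auto simp: I_def)
      hence "u \<in> M \<and> v \<in> M \<and> h u = h v"
        using eq B by (auto simp: f_def split: if_splits)
      thus False using h(1) ne by (auto simp: inj_on_def)
    qed
  qed
  hence "chromatic_number V E \<le> k + 1 + card M" by (rule chromatic_number_le)
  thus ?thesis using cardM by (simp add: k_def I_def)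
qed

section \<open>Enumerating edges by their larger endpoint\<close>

lemma potential_edges_eq_image:
  "potential_edges n = (\<lambda>(v, u). {u, v}) ` (SIGMA v:{1..n}. {1..<v})"
proof
  show "potential_edges n \<subseteq> (\<lambda>(v, u). {u, v}) ` (SIGMA v:{1..n}. {1..<v})"
  proof
    fix e assume "e \<in> potential_edges n"
    then obtain i j where ij: "e = {i, j}" "i \<in> {1..n}" "j \<in> {1..n}" "i \<noteq> j"
      unfolding potential_edges_def by blast
    show "e \<in> (\<lambda>(v, u). {u, v}) ` (SIGMA v:{1..n}. {1..<v})"
    proof (cases "i < j")
      case True
      thus ?thesis using ij by (intro image_eqI [of _ _ "(j, i)"]) auto
    next
      case False
      thus ?thesis using ij by (intro image_eqI [of _ _ "(i, j)"]) auto
    qed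
  qed
qed (force simp: potential_edges_def)

lemma finite_potential_edges: "finite (potential_edges n)"
  by (simp add: potential_edges_eq_image)

lemma sum_potential_edges:
  "(\<Sum>e\<in>potential_edges n. g e) = (\<Sum>v\<in>{1..n}. \<Sum>u\<in>{1..<v}. g {u, v})"
proof -
  have "inj_on (\<lambda>(v, u). {u, v}) (SIGMA v:{1..n}. {1..<v})"
    by (auto simp: inj_on_def doubleton_eq_iff)
  thus ?thesis
    by (simp add: potential_edges_eq_image sum.reindex sum.Sigma case_prod_unfold)
qed

section \<open>Exponential moments of edge counts and of the chromatic number\<close>

lemma expectation_exp_card:
  assumes A: "finite A" "I \<subseteq> A" and q: "\<And>x. x \<in> A \<Longrightarrow> 0 \<le> q x \<and> q x \<le> 1"
  shows "measure_pmf.expectation (Pi_pmf A False (\<lambda>x. bernoulli_pmf (q x)))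
      (\<lambda>\<omega>. exp (s * real (card {x \<in> I. \<omega> x}))) = (\<Prod>x\<in>I. 1 + q x * (exp s - 1))"
proof -
  have finI: "finite I" using A finite_subset by blast
  \<comment> \<open>The exponential of a count is a product with one factor per coordinate, equal to
    1 off \<open>I\<close>, so its expectation factorizes by independence.\<close>
  have "exp (s * real (card {x \<in> I. \<omega> x})) = (\<Prod>x\<in>A. if x \<in> I \<and> \<omega> x then exp s else 1)" for \<omega>
  proof -
    have "(\<Prod>x\<in>A. if x \<in> I \<and> \<omega> x then exp s else 1) = (\<Prod>x\<in>{x \<in> I. \<omega> x}. exp s)"
      using A by (intro prod.mono_neutral_cong_right) auto
    thus ?thesis by (simp add: exp_of_nat2_mult)
  qed
  hence "measure_pmf.expectation (Pi_pmf A False (\<lambda>x. bernoulli_pmf (q x)))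
      (\<lambda>\<omega>. exp (s * real (card {x \<in> I. \<omega> x}))) =
    measure_pmf.expectation (Pi_pmf A False (\<lambda>x. bernoulli_pmf (q x)))
      (\<lambda>\<omega>. \<Prod>x\<in>A. if x \<in> I \<and> \<omega> x then exp s else 1)"
    by simp
  also have "\<dots> = (\<Prod>x\<in>A. measure_pmf.expectation (bernoulli_pmf (q x))
      (\<lambda>v. if x \<in> I \<and> v then exp s else 1))"
    using A(1) by (intro expectation_prod_Pi_pmf [of A _ "\<lambda>x v. if x \<in> I \<and> v then exp s else 1"]
        integrable_measure_pmf_finite) auto
  also have "\<dots> = (\<Prod>x\<in>A. if x \<in> I then 1 + q x * (exp s - 1) else 1)"
    using q by (intro prod.cong) (auto simp: algebra_simps)
  also have "\<dots> = (\<Prod>x\<in>I. 1 + q x * (exp s - 1))"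
    using A by (intro prod.mono_neutral_cong_right) auto
  finally show ?thesis .
qed

lemma prod_one_plus_le_exp_sum:
  fixes a :: "'a \<Rightarrow> real"
  assumes "\<And>x. x \<in> I \<Longrightarrow> 0 \<le> a x"
  shows "(\<Prod>x\<in>I. 1 + a x) \<le> exp (\<Sum>x\<in>I. a x)"
proof (cases "finite I")
  case True
  have "(\<Prod>x\<in>I. 1 + a x) \<le> (\<Prod>x\<in>I. exp (a x))"
    using assms by (intro prod_mono) (auto intro: add_nonneg_nonneg)
  thus ?thesis using True by (simp add: exp_sum)
qed simp

lemma potential_edgesD:
  assumes "e \<in> potential_edges n"
  shows "\<exists>u v. e = {u, v} \<and> 1 \<le> u \<and> u < v \<and> v \<le> n"
proof -
  obtain x where x: "x \<in> (SIGMA v:{1..n}. {1..<v})" "e = (\<lambda>(v, u). {u, v}) x"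
    using assms unfolding potential_edges_eq_image by (rule imageE)
  thus ?thesis by (intro exI [of _ "snd x"] exI [of _ "fst x"]) auto
qed

lemma mgf_chromatic_number:
  fixes P :: "nat \<Rightarrow> nat \<Rightarrow> real" and n :: nat
  defines "M \<equiv> Pi_pmf (potential_edges n) False (\<lambda>e. bernoulli_pmf (P (Min e) (Max e)))"
    and "X \<equiv> \<lambda>\<omega>. real (chromatic_number {1..n} {e \<in> potential_edges n. \<omega> e})"
  assumes P: "\<forall>v\<in>{1..n}. \<forall>u\<in>{1..<v}. 0 \<le> P u v \<and> P u v \<le> 1"
    and f: "\<forall>v\<in>{1..n}. f v < N" "\<forall>b. block_weight P n f b \<le> 2"
    and l: "\<bar>l\<bar> \<le> 1"
  shows "measure_pmf.expectation M (\<lambda>\<omega>. exp (l * (X \<omega> - measure_pmf.expectation M X)))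
    \<le> exp (l\<^sup>2 * exp (4 * exp 2) * real N)"
proof -
  define G where "G \<omega> = {e \<in> potential_edges n. \<omega> e}" for \<omega>
  define q where "q e = P (Min e) (Max e)" for e
  define B where "B b = {v \<in> {1..n}. f v = b}" for b
  \<comment> \<open>\<open>Max\<close> selects the later block, so the \<open>A b\<close> are
    disjoint. Every edge of \<open>A b\<close> meets \<open>B b\<close>, and every edge inside
    \<open>B b\<close> belongs to \<open>A b\<close>.\<close>
  define A where "A b = {e \<in> potential_edges n. Max (f ` e) = b}" for b
  define I where "I b = {e \<in> potential_edges n. e \<subseteq> B b}" for b
  \<comment> \<open>The 1 accounts for the shared color in the deletion bound, the count for the
    private ones.\<close>
  define Y where "Y b \<omega> = 1 + real (card {e \<in> I b. \<omega> e})" for b \<omega>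
  have q: "0 \<le> q e \<and> q e \<le> 1" if "e \<in> potential_edges n" for e
    using potential_edgesD [OF that] P by (auto simp: q_def)
  have G: "finite (G \<omega>)" "\<And>v. {v} \<notin> G \<omega>" for \<omega>
    using finite_potential_edges by (auto simp: G_def potential_edges_def doubleton_eq_iff)
  have finA: "finite (A b)" for b using finite_potential_edges by (simp add: A_def)
  have IA: "I b \<subseteq> A b" for b
  proof
    fix e assume e: "e \<in> I b"
    then obtain u v where "e = {u, v}" using potential_edgesD [of e] unfolding I_def by blast
    thus "e \<in> A b" using e by (auto simp: I_def A_def B_def)
  qed
  have UA: "(\<Union>b\<in>{..<N}. A b) = potential_edges n"
  proof
    show "potential_edges n \<subseteq> (\<Union>b\<in>{..<N}. A b)"
    proof
      fix e assume e: "e \<in> potential_edges n"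
      then obtain u v where "e = {u, v}" "1 \<le> u" "u < v" "v \<le> n" using potential_edgesD by blast
      thus "e \<in> (\<Union>b\<in>{..<N}. A b)" using e f(1) by (auto simp: A_def)
    qed
  qed (auto simp: A_def)
  have bw: "(\<Sum>e\<in>I b. q e) \<le> 2" for b
  proof -
    have "(\<Sum>e\<in>I b. q e) = (\<Sum>e\<in>potential_edges n. if e \<subseteq> B b then q e else 0)"
      unfolding I_def using finite_potential_edges by (simp add: sum.inter_filter)
    also have "\<dots> = block_weight P n f b"
      unfolding sum_potential_edges block_weight_def
      by (intro sum.cong refl) (auto simp: B_def q_def)
    finally show ?thesis using f(2) by simp
  qed
  \<comment> \<open>Each edge contributes a factor at most \<open>exp (q e * (exp 2 - 1))\<close>.
    As the weight is at most 2, the total exponent is at most \<open>2 + 2 * (exp 2 - 1)\<close>;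
    squaring later gives \<open>exp (4 * exp 2)\<close>.\<close>
  have EY: "measure_pmf.expectation (Pi_pmf (A b) False (\<lambda>e. bernoulli_pmf (q e)))
      (\<lambda>\<omega>. exp (2 * Y b \<omega>)) \<le> exp (2 * exp 2)" for b
  proof -
    have "measure_pmf.expectation (Pi_pmf (A b) False (\<lambda>e. bernoulli_pmf (q e)))
        (\<lambda>\<omega>. exp (2 * Y b \<omega>)) = exp 2 * (\<Prod>e\<in>I b. 1 + q e * (exp 2 - 1))"
      using expectation_exp_card [OF finA IA, of b q 2] q
      by (simp add: Y_def distrib_left exp_add A_def)
    also have "\<dots> \<le> exp 2 * exp (\<Sum>e\<in>I b. q e * (exp 2 - 1))"
      using q by (intro mult_left_mono prod_one_plus_le_exp_sum) (auto simp: I_def)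
    also have "\<dots> = exp (2 + (\<Sum>e\<in>I b. q e) * (exp 2 - 1))"
      by (simp add: exp_add sum_distrib_right)
    also have "\<dots> \<le> exp (2 + 2 * (exp 2 - 1))"
      using mult_right_mono [OF bw [of b], of "exp 2 - 1"] by simp
    finally show ?thesis by (simp add: algebra_simps)
  qed
  have "measure_pmf.expectation (Pi_pmf (\<Union>b\<in>{..<N}. A b) False (\<lambda>e. bernoulli_pmf (q e)))
      (\<lambda>\<omega>. exp (l * (X \<omega> - measure_pmf.expectation
        (Pi_pmf (\<Union>b\<in>{..<N}. A b) False (\<lambda>e. bernoulli_pmf (q e))) X)))
    \<le> (\<Prod>b\<in>{..<N}. exp (l\<^sup>2 * exp (4 * exp 2)))"
  proof (rule mgf_le_prod_blocks [where Y = Y])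
    show "disjoint_family_on A {..<N}" by (auto simp: disjoint_family_on_def A_def)
    show "\<forall>b\<in>{..<N}. \<exists>L. (\<forall>\<omega> \<omega>'. (\<forall>i. i \<notin> A b \<longrightarrow> \<omega> i = \<omega>' i) \<longrightarrow> L \<omega> = L \<omega>') \<and>
        (\<forall>\<omega>. L \<omega> \<le> X \<omega> \<and> X \<omega> \<le> L \<omega> + Y b \<omega>)"
    proof
      fix b
      \<comment> \<open>Deleting \<open>B b\<close> destroys every edge of \<open>A b\<close>, so
        \<open>L\<close> ignores these coordinates.\<close>
      define L where "L \<omega> = real (chromatic_number ({1..n} - B b) (G \<omega>))" for \<omega>
      have "L \<omega> = L \<omega>'" if eq: "\<forall>i. i \<notin> A b \<longrightarrow> \<omega> i = \<omega>' i" for \<omega> \<omega>'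
      proof -
        have "{u, v} \<in> G \<omega> \<longleftrightarrow> {u, v} \<in> G \<omega>'" if "u \<in> {1..n} - B b" "v \<in> {1..n} - B b" for u v
        proof -
          have "Max (f ` {u, v}) \<noteq> b" using that by (auto simp: B_def max_def)
          hence "{u, v} \<notin> A b" unfolding A_def by blast
          thus ?thesis using eq by (simp add: G_def)
        qed
        thus ?thesis unfolding L_def by (metis chromatic_number_cong)
      qed
      moreover have "L \<omega> \<le> X \<omega>" for \<omega>
        unfolding L_def X_def G_def [symmetric] using chromatic_number_mono [OF _ G(2)] by simp
      moreover have "X \<omega> \<le> L \<omega> + Y b \<omega>" for \<omega>
      proof -
        have "{e \<in> G \<omega>. e \<subseteq> B b} = {e \<in> I b. \<omega> e}" by (auto simp: G_def I_def)
        thus ?thesis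
          unfolding L_def X_def Y_def G_def [symmetric]
          using chromatic_number_le_delete [OF _ G, of "{1..n}" \<omega> "B b"] by simp
      qed
      ultimately show "\<exists>L. (\<forall>\<omega> \<omega>'. (\<forall>i. i \<notin> A b \<longrightarrow> \<omega> i = \<omega>' i) \<longrightarrow> L \<omega> = L \<omega>') \<and>
        (\<forall>\<omega>. L \<omega> \<le> X \<omega> \<and> X \<omega> \<le> L \<omega> + Y b \<omega>)"
        by (intro exI [of _ L]) simp
    qed
    show "\<forall>b\<in>{..<N}. \<forall>\<omega> \<omega>'. (\<forall>i\<in>A b. \<omega> i = \<omega>' i) \<longrightarrow> Y b \<omega> = Y b \<omega>'"
    proof (intro ballI allI impI)
      fix b and \<omega> \<omega>' :: "nat set \<Rightarrow> bool"
      assume "\<forall>i\<in>A b. \<omega> i = \<omega>' i"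
      hence "{e \<in> I b. \<omega> e} = {e \<in> I b. \<omega>' e}" using IA by blast
      thus "Y b \<omega> = Y b \<omega>'" by (simp add: Y_def)
    qed
    show "\<forall>b\<in>{..<N}. \<forall>Z. (\<forall>\<omega>. 0 \<le> Z \<omega> \<and> Z \<omega> \<le> Y b \<omega>) \<longrightarrow>
        measure_pmf.expectation (Pi_pmf (A b) False (\<lambda>e. bernoulli_pmf (q e)))
          (\<lambda>\<omega>. exp (l * (Z \<omega> - measure_pmf.expectation
            (Pi_pmf (A b) False (\<lambda>e. bernoulli_pmf (q e))) Z))) \<le> exp (l\<^sup>2 * exp (4 * exp 2))"
    proof (intro ballI allI impI)
      fix b Z assume Z: "\<forall>\<omega>. 0 \<le> Z \<omega> \<and> Z \<omega> \<le> Y b \<omega>"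
      let ?p = "Pi_pmf (A b) False (\<lambda>e. bernoulli_pmf (q e))"
      have "(measure_pmf.expectation ?p (\<lambda>\<omega>. exp (2 * Y b \<omega>)))\<^sup>2 \<le> (exp (2 * exp 2))\<^sup>2"
        by (intro power_mono EY) simp
      also have "\<dots> = exp (4 * exp 2)" by (simp flip: exp_double)
      finally have "exp (l\<^sup>2 * (measure_pmf.expectation ?p (\<lambda>\<omega>. exp (2 * Y b \<omega>)))\<^sup>2)
          \<le> exp (l\<^sup>2 * exp (4 * exp 2))" by (simp add: mult_left_mono)
      moreover have "measure_pmf.expectation ?p
          (\<lambda>\<omega>. exp (l * (Z \<omega> - measure_pmf.expectation ?p Z)))
        \<le> exp (l\<^sup>2 * (measure_pmf.expectation ?p (\<lambda>\<omega>. exp (2 * Y b \<omega>)))\<^sup>2)"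
        using Z finA by (intro mgf_le_of_bounded l finite_set_Pi_pmf) auto
      ultimately show "measure_pmf.expectation ?p
          (\<lambda>\<omega>. exp (l * (Z \<omega> - measure_pmf.expectation ?p Z))) \<le> exp (l\<^sup>2 * exp (4 * exp 2))"
        by linarith
    qed
  qed (auto simp: finA)
  thus ?thesis
    unfolding UA by (simp add: M_def q_def mult_ac flip: exp_of_nat_mult)
qed

section \<open>The tail bound: choice of constants, blocks and exponent\<close>

theorem theorem5:
  "\<exists>c>0. \<exists>c'>0. \<forall>n\<ge>2. \<forall>P :: nat \<Rightarrow> nat \<Rightarrow> real.
     edge_probability_matrix n P \<longrightarrow> average_edge_probability n P > 0 \<longrightarrow>
       has_normal_tails c c'
         (measure_pmf (inhomogeneous_random_graph n P))
         (\<lambda>E. real (chromatic_number {1..n} E))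
         (real n * ln (real n) * sqrt (average_edge_probability n P))
         (real n * sqrt (average_edge_probability n P))"
proof -
  \<comment> \<open>\<open>K\<close> is the cost per block in the exponential moment bound. The 12
    comes from optimizing the exponent below, and \<open>ln 2\<close> is the smallest value of
    \<open>ln (real n)\<close>.\<close>
  define K :: real where "K = exp (4 * exp 2)"
  define c :: real where "c = ln 2 / (12 * K)"
  have K: "K \<ge> 1" by (simp add: K_def)
  have c: "c > 0" using K by (simp add: c_def)
  have "has_normal_tails c 2
         (measure_pmf (inhomogeneous_random_graph n P))
         (\<lambda>E. real (chromatic_number {1..n} E))
         (real n * ln (real n) * sqrt (average_edge_probability n P))
         (real n * sqrt (average_edge_probability n P))"
    if n: "n \<ge> 2" and P: "edge_probability_matrix n P" and p0: "average_edge_probability n P > 0"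
    for n and P :: "nat \<Rightarrow> nat \<Rightarrow> real"
  proof -
    define p where "p = average_edge_probability n P"
    define v where "v = real n * sqrt p"
    define W where "W = (\<Sum>v\<in>{1..n}. \<Sum>u\<in>{1..<v}. P u v)"
    define M where "M = Pi_pmf (potential_edges n) False (\<lambda>e. bernoulli_pmf (P (Min e) (Max e)))"
    define X where "X = (\<lambda>\<omega>. real (chromatic_number {1..n} {e \<in> potential_edges n. \<omega> e}))"
    have v: "v > 0" using n p0 by (simp add: v_def p_def)
    have ln2: "ln 2 \<le> ln (real n)" "0 < ln (2::real)" "0 < ln (real n)" using n by auto
    have finM: "finite (set_pmf M)"
      unfolding M_def by (rule finite_set_Pi_pmf [OF finite_potential_edges]) simp
    have P': "\<forall>v\<in>{1..n}. \<forall>u\<in>{1..<v}. 0 \<le> P u v \<and> P u v \<le> 1"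
      using P by (auto simp: edge_probability_matrix_def)
    have W: "W \<le> v\<^sup>2 / 2"
    proof -
      have choose: "real (n choose 2) = real n * (real n - 1) / 2"
        using n by (simp add: choose_two real_of_nat_div of_nat_diff)
      have "{(i, j). i \<in> {1..n} \<and> j \<in> {1..n} \<and> i < j} =
          (\<lambda>(v, u). (u, v)) ` (SIGMA v:{1..n}. {1..<v})"
        by auto
      hence "(\<Sum>(i, j)\<in>{(i, j). i \<in> {1..n} \<and> j \<in> {1..n} \<and> i < j}. P i j) = W"
        unfolding W_def by (simp add: sum.reindex inj_on_def sum.Sigma case_prod_unfold)
      hence "W = p * real (n choose 2)"
        using n by (simp add: p_def average_edge_probability_def)
      also have "\<dots> \<le> p * ((real n)\<^sup>2 / 2)"
        unfolding choose using p0 by (intro mult_left_mono) (auto simp: p_def power2_eq_square algebra_simps)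
      also have "\<dots> = v\<^sup>2 / 2" using p0 by (simp add: v_def p_def power_mult_distrib)
      finally show ?thesis .
    qed
    have tail: "measure_pmf.prob M {\<omega>. t \<le> \<bar>X \<omega> - measure_pmf.expectation M X\<bar>}
        \<le> 2 * exp (- (t\<^sup>2 / (12 * K * v)))" if t: "0 < t" "t \<le> v" and v1: "1 \<le> v" for t
    proof -
      \<comment> \<open>This balances \<open>k\<close> against \<open>W / k\<close>: rounding up at
        most doubles \<open>v\<close>, and \<open>W / k\<close> is at most \<open>v / 2\<close>, so
        \<open>N\<close> is at most \<open>3 * v\<close>.\<close>
      define k where "k = nat \<lceil>v\<rceil>"
      have k: "v \<le> real k" "real k \<le> 2 * v" "k \<ge> 1" using v1 unfolding k_def by linarith+
      obtain f N where f: "\<forall>v\<in>{1..n}. f v < N" "\<forall>b. block_weight P n f b \<le> 2"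
        and "real N \<le> real k + W / real k"
        using exists_light_partition [OF k(3), of n P] P' unfolding W_def by blast
      moreover have "W / real k \<le> v / 2"
      proof -
        have "W \<le> v / 2 * v" using W by (simp add: power2_eq_square)
        also have "\<dots> \<le> v / 2 * real k" using k(1) v by (intro mult_left_mono) auto
        finally show ?thesis using k(3) by (simp add: divide_le_eq)
      qed
      ultimately have N: "real N \<le> 3 * v" using k(2) v by linarith
      \<comment> \<open>The minimizer of \<open>- l * t + l\<^sup>2 * K * (3 * v)\<close>. The range
        \<open>t \<le> v\<close> ensures \<open>l \<le> 1\<close>.\<close>
      define l where "l = t / (6 * K * v)"
      have l: "0 < l" "l \<le> 1" using t v K mult_mono [of 1 "6 * K" t v] by (auto simp: l_def)
      have "measure_pmf.prob M {\<omega>. t \<le> \<bar>X \<omega> - measure_pmf.expectation M X\<bar>}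
          \<le> 2 * (exp (- l * t) * exp (l\<^sup>2 * K * real N))"
      proof (rule tail_le_of_mgf [OF finM _ l(1)])
        fix s assume s: "\<bar>s\<bar> = l"
        hence "s\<^sup>2 = l\<^sup>2" by (metis power2_abs)
        thus "measure_pmf.expectation M (\<lambda>\<omega>. exp (s * (X \<omega> - measure_pmf.expectation M X)))
            \<le> exp (l\<^sup>2 * K * real N)"
          using mgf_chromatic_number [OF P' f, of s] s l(2) by (simp add: K_def M_def X_def)
      qed
      also have "exp (- l * t) * exp (l\<^sup>2 * K * real N) \<le> exp (- (t\<^sup>2 / (12 * K * v)))"
      proof -
        have "l\<^sup>2 * K * real N \<le> l\<^sup>2 * K * (3 * v)" using N K by (intro mult_left_mono) auto
        moreover have "- l * t + l\<^sup>2 * K * (3 * v) = - (t\<^sup>2 / (12 * K * v))"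
          using v K by (simp add: l_def field_simps power2_eq_square)
        ultimately show ?thesis unfolding mult_exp_exp by simp
      qed
      finally show ?thesis by simp
    qed
    have main: "measure_pmf.prob M {\<omega>. t \<le> \<bar>X \<omega> - measure_pmf.expectation M X\<bar>}
        \<le> 2 * exp (- c * t\<^sup>2 / (v * ln (real n)))" if t: "0 \<le> t" "t \<le> v" for t
    proof -
      have "c * t\<^sup>2 / (v * ln (real n)) \<le> c * t\<^sup>2 / (v * ln 2)"
        using ln2 v c by (intro divide_left_mono mult_left_mono) auto
      also have "\<dots> = t\<^sup>2 / (12 * K * v)" using ln2 by (simp add: c_def)
      finally have le: "c * t\<^sup>2 / (v * ln (real n)) \<le> t\<^sup>2 / (12 * K * v)" .
      show ?thesis
      proof (cases "0 < t \<and> 1 \<le> v")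
        case True
        have "exp (- (t\<^sup>2 / (12 * K * v))) \<le> exp (- c * t\<^sup>2 / (v * ln (real n)))"
          using le by simp
        thus ?thesis using tail [of t] t True by linarith
      next
        case False
        \<comment> \<open>Now \<open>t = 0\<close> or \<open>v < 1\<close>. Either way the exponent
          is at least \<open>- 1 / 2\<close>, so the claimed bound is at least 1 and holds
          trivially.\<close>
        have "t\<^sup>2 \<le> v"
        proof (cases "t = 0")
          case False
          hence "v < 1" using \<open>\<not> (0 < t \<and> 1 \<le> v)\<close> t by linarith
          hence "t * t \<le> v * 1" using t v by (intro mult_mono) auto
          thus ?thesis by (simp add: power2_eq_square)
        qed (use v in simp)
        also have "v \<le> (12 * K * v) / 2" using K v by simp
        finally have "t\<^sup>2 / (12 * K * v) \<le> 1 / 2" using K v by (simp add: divide_le_eq)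
        hence "1 / 2 \<le> 1 + - c * t\<^sup>2 / (v * ln (real n))" using le by simp
        also have "\<dots> \<le> exp (- c * t\<^sup>2 / (v * ln (real n)))" by (rule exp_ge_add_one_self)
        finally show ?thesis
          using measure_pmf.prob_le_1 [of M "{\<omega>. t \<le> \<bar>X \<omega> - measure_pmf.expectation M X\<bar>}"] by linarith
      qed
    qed
    \<comment> \<open>The random graph is the image of the indicators under \<open>M\<close>, so its
      expectation and probabilities pull back to \<open>M\<close>.\<close>
    show ?thesis
      using main
      by (simp add: has_normal_tails_def inhomogeneous_random_graph_def vimage_def
          X_def M_def v_def p_def mult_ac)
  qed
  thus ?thesis by (rule_tac exI [of _ c], intro conjI c, rule_tac exI [of _ 2]) simp
qed

end
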